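(* Let $k\ge 2$. For every deterministic online algorithm for the problem restricted to instances in which all jobs have processing time exactly $k$ (with arbitrary positive weights), and every $R<\frac{3}{2}\sqrt3\approx 2.598$, there is an instance $I$ of this kind with $\mathrm{OPT}(I)\ge R\cdot\mathrm{ALG}(I)$ and $\mathrm{ALG}(I)>0$; that is, the competitive ratio of any deterministic online algorithm is at least $\frac{3}{2}\sqrt3$.
   Context: Model: online preemptive scheduling on a single machine (preemption with resume) in discrete time. Each job $j$ has an integer release time $r_j$, integer processing time $p_j$, integer deadline $d_j$ and positive real weight $w_j$; job $j$ becomes known to the algorithm only at time $r_j$, and the algorithm's decision at time $t$ depends only on jobs released by time $t$. At each integer time $t$ the machine processes at most one unit of one job, occupying $[t,t+1)$; a job is completed on time if it receives $p_j$ units of processing at integer times $t$ with $r_j\le t<d_j$. $\mathrm{ALG}(I)$ is the total weight of jobs the algorithm completes on time on instance $I$; $\mathrm{OPT}(I)$ is the maximum total weight achievable by an offline schedule. The competitive ratio of an algorithm is the infimum of $R$ such that $\mathrm{OPT}(I)\le R\cdot\mathrm{ALG}(I)$ for all instances $I$.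
   Formalization: The instance form with ALG(I)>0 is stated for algorithms that earn positive weight on at least one admissible instance, since it fails for the algorithm that always idles; the competitive-ratio bound is stated for every deterministic online algorithm. *)

theory Defs
  imports Complex_Main "HOL-Library.Extended_Real"
begin

text \<open>The tag lets an instance (a finite set of jobs) contain several jobs with
  the same parameters. It is revealed together with the job.\<close>

datatype job =
  Job (tag: nat) (release: int) (ptime: nat) (deadline: int) (weight: real)

definition uniform_instance :: "nat \<Rightarrow> job set \<Rightarrow> bool" where
  "uniform_instance k I \<longleftrightarrow> finite I \<and> (\<forall>j\<in>I. ptime j = k \<and> weight j > 0)"

text \<open>A schedule names the job, if any, that occupies the machine during \<open>[t, t + 1)\<close>.\<close>

type_synonym schedule = "int \<Rightarrow> job option"

definition is_schedule :: "job set \<Rightarrow> schedule \<Rightarrow> bool" where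
  "is_schedule I S \<longleftrightarrow> (\<forall>t j. S t = Some j \<longrightarrow> j \<in> I \<and> release j \<le> t)"

text \<open>The inequality means that units spent on a job beyond its processing time
  are wasted but do no harm.\<close>

definition completed :: "job set \<Rightarrow> schedule \<Rightarrow> job set" where
  "completed I S =
    {j \<in> I. ptime j \<le> card {t. release j \<le> t \<and> t < deadline j \<and> S t = Some j}}"

definition profit :: "job set \<Rightarrow> schedule \<Rightarrow> real" where
  "profit I S = (\<Sum>j\<in>completed I S. weight j)"

definition OPT :: "job set \<Rightarrow> real" where
  "OPT I = Max {profit I S | S. is_schedule I S}"

definition released :: "job set \<Rightarrow> int \<Rightarrow> job set" where
  "released I t = {j \<in> I. release j \<le> t}"

text \<open>A deterministic online algorithm maps the current time and the set of jobs
  released so far to the job processed next. Its own earlier decisions are functions of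
  the same data, since the sets of jobs known at earlier times can be recovered from the
  release times.\<close>

type_synonym algorithm = "int \<Rightarrow> job set \<Rightarrow> job option"

definition online_algorithm :: "algorithm \<Rightarrow> bool" where
  "online_algorithm A \<longleftrightarrow> (\<forall>t K j. A t K = Some j \<longrightarrow> j \<in> K)"

definition run :: "algorithm \<Rightarrow> job set \<Rightarrow> schedule" where
  "run A I = (\<lambda>t. A t (released I t))"

definition ALG :: "algorithm \<Rightarrow> job set \<Rightarrow> real" where
  "ALG A I = profit I (run A I)"

text \<open>The value is \<open>\<infinity>\<close> if no real \<open>R\<close> qualifies.\<close>

definition competitive_ratio :: "nat \<Rightarrow> algorithm \<Rightarrow> ereal" where
  "competitive_ratio k A =
    Inf (ereal ` {R. \<forall>I. uniform_instance k I \<longrightarrow> OPT I \<le> R * ALG A I})"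

lemma is_schedule_run: "online_algorithm A \<Longrightarrow> is_schedule I (run A I)"
  by (force simp: online_algorithm_def is_schedule_def run_def released_def)

lemma finite_profits:
  assumes "finite I"
  shows "finite {profit I S | S. is_schedule I S}"
proof (rule finite_subset)
  show "{profit I S | S. is_schedule I S} \<subseteq> sum weight ` Pow I"
    by (auto simp: profit_def completed_def)
qed (use assms in simp)

lemma profit_le_OPT: "finite I \<Longrightarrow> is_schedule I S \<Longrightarrow> profit I S \<le> OPT I"
  unfolding OPT_def by (rule Max_ge[OF finite_profits]) auto

lemma OPT_attained:
  assumes "finite I"
  shows "\<exists>S. is_schedule I S \<and> OPT I = profit I S"
proof -
  have "is_schedule I (\<lambda>_. None)"
    by (simp add: is_schedule_def)
  then have "OPT I \<in> {profit I S | S. is_schedule I S}"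
    unfolding OPT_def by (intro Max_in finite_profits assms) auto
  then show ?thesis by auto
qed

end

theory Submission imports Defs begin

text \<open>
  The adversary releases tight jobs \<open>J\<^sub>0, J\<^sub>1, \<dots>\<close> (deadline minus release time equal to \<open>k\<close>)
  such that \<open>J\<^sub>n\<close> and \<open>J\<^sub>n\<^sub>+\<^sub>1\<close> overlap but \<open>J\<^sub>n\<close> and \<open>J\<^sub>n\<^sub>+\<^sub>2\<close> do not. The algorithm has to abandon
  \<open>J\<^sub>n\<close> in order to start \<open>J\<^sub>n\<^sub>+\<^sub>1\<close>. As soon as it does not start \<open>J\<^sub>n\<^sub>+\<^sub>1\<close>, the adversary stops; the
  algorithm earns at most \<open>w\<^sub>n\<close>, while the offline schedule earns \<open>w\<^sub>n\<^sub>+\<^sub>1 + w\<^sub>n\<^sub>-\<^sub>1 + w\<^sub>n\<^sub>-\<^sub>3 + \<dots>\<close>. Making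
  the latter equal to \<open>R w\<^sub>n\<close> leads to \<open>w\<^sub>n\<^sub>+\<^sub>3 = R (w\<^sub>n\<^sub>+\<^sub>2 - w\<^sub>n)\<close>. Since \<open>3\<surd>3/2\<close> is the minimum of
  \<open>x\<^sup>3 / (x\<^sup>2 - 1)\<close> over \<open>x > 1\<close>, for smaller \<open>R\<close> the growth factors of this sequence decrease
  geometrically until \<open>w\<^sub>n\<^sub>+\<^sub>1 \<le> w\<^sub>n\<close>, and there the adversary wins whatever the algorithm does.

  To force a positive profit of the algorithm, this game is played, with large weights,
  after an instance on which the algorithm earns something.
\<close>

section \<open>The weight sequence\<close>

text \<open>The initial values solve \<open>v 1 = R * v 0\<close> and
  \<open>v 2 + v 0 = R * v 1\<close>; the recurrence is the difference of two such equations whose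
  indices differ by two.\<close>

fun adv_weight :: "real \<Rightarrow> nat \<Rightarrow> real" where
  "adv_weight R 0 = 1"
| "adv_weight R (Suc 0) = R"
| "adv_weight R (Suc (Suc 0)) = R\<^sup>2 - 1"
| "adv_weight R (Suc (Suc (Suc n))) = R * (adv_weight R (Suc (Suc n)) - adv_weight R n)"

definition alt_sum :: "(nat \<Rightarrow> real) \<Rightarrow> nat \<Rightarrow> real" where
  "alt_sum w n = (\<Sum>i\<in>{i. i \<le> n \<and> (even i \<longleftrightarrow> even n)}. w i)"

lemma alt_sum_Suc_Suc: "alt_sum w (Suc (Suc n)) = w (Suc (Suc n)) + alt_sum w n"
proof -
  have "{i. i \<le> Suc (Suc n) \<and> (even i \<longleftrightarrow> even (Suc (Suc n)))} =
      insert (Suc (Suc n)) {i. i \<le> n \<and> (even i \<longleftrightarrow> even n)}"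
    by (auto simp: le_Suc_eq)
  then show ?thesis
    unfolding alt_sum_def by simp
qed

lemma alt_sum_0: "alt_sum w 0 = w 0"
proof -
  have "{i::nat. i \<le> 0 \<and> (even i \<longleftrightarrow> even (0::nat))} = {0}" by auto
  then show ?thesis unfolding alt_sum_def by simp
qed

lemma alt_sum_1: "alt_sum w (Suc 0) = w (Suc 0)"
proof -
  have "{i. i \<le> Suc 0 \<and> (even i \<longleftrightarrow> even (Suc 0))} = {Suc 0}" by (auto simp: le_Suc_eq)
  then show ?thesis unfolding alt_sum_def by simp
qed

lemma alt_sum_mono: "(\<And>i. i \<le> n \<Longrightarrow> v i \<le> w i) \<Longrightarrow> alt_sum v n \<le> alt_sum w n"
  unfolding alt_sum_def by (rule sum_mono) auto

lemma alt_sum_scale: "alt_sum (\<lambda>i. c * w i) n = c * alt_sum w n"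
  unfolding alt_sum_def by (simp add: sum_distrib_left)

lemma alt_sum_adv_weight: "alt_sum (adv_weight R) (Suc n) = R * adv_weight R n"
proof (induction n rule: induct_nat_012)
  case 0
  show ?case by (simp add: alt_sum_1)
next
  case 1
  show ?case by (simp add: alt_sum_Suc_Suc alt_sum_0 power2_eq_square)
next
  case (ge2 n)
  then show ?case by (subst alt_sum_Suc_Suc) (simp add: algebra_simps)
qed

lemma three_halves_sqrt3_minimum:
  fixes x :: real
  assumes "x > 0"
  shows "3 / 2 * sqrt 3 * (1 - 1 / x\<^sup>2) \<le> x"
proof -
  define s :: real where "s = sqrt 3"
  have s: "s > 0" "s * s = 3" by (simp_all add: s_def)
  \<comment> \<open>With denominators cleared, the claim is a cubic inequality with a double root at
    \<open>sqrt 3\<close>, the point of equality.\<close>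
  have "0 \<le> (x - s)\<^sup>2 * (2 * x + s)"
    using assms s by (intro mult_nonneg_nonneg) auto
  also have "\<dots> = 2 * x ^ 3 - 3 * s * x\<^sup>2 + s * (s * s)"
    by (simp add: power2_eq_square power3_eq_cube algebra_simps)
  also have "\<dots> = 2 * x ^ 3 - 3 * s * x\<^sup>2 + 3 * s"
    by (simp add: s)
  finally have "3 / 2 * s * (x\<^sup>2 - 1) \<le> x * x\<^sup>2"
    by (simp add: power2_eq_square power3_eq_cube algebra_simps)
  moreover have "3 / 2 * s * (1 - 1 / x\<^sup>2) = 3 / 2 * s * (x\<^sup>2 - 1) / x\<^sup>2"
    using assms by (simp add: diff_divide_distrib right_diff_distrib)
  ultimately show ?thesis
    using assms by (simp add: s_def divide_le_eq)
qed

text \<open>Otherwise all growth factors \<open>x n\<close> exceed 1, yet any two consecutive ones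
  force the next to be at most \<open>c < 1\<close> times their maximum.\<close>

lemma adv_weight_not_increasing:
  assumes "1 \<le> R" and "R < 3 / 2 * sqrt 3"
  shows "\<exists>n. adv_weight R (Suc n) \<le> adv_weight R n"
proof (rule ccontr)
  let ?v = "adv_weight R"
  assume "\<not> ?thesis"
  then have inc: "?v n < ?v (Suc n)" for n by (simp add: not_le)
  have pos: "0 < ?v n" for n
  proof (induction n)
    case (Suc n)
    then show ?case using inc[of n] by linarith
  qed simp
  define x where "x n = ?v (Suc n) / ?v n" for n
  define c where "c = R / (3 / 2 * sqrt 3)"
  have c: "0 < c" "c < 1" "R = c * (3 / 2 * sqrt 3)"
    using assms by (auto simp: c_def)
  have x_gt_1: "1 < x n" for n
    using inc[of n] pos[of n] by (simp add: x_def)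
  \<comment> \<open>The recurrence divided by \<open>?v (n + 2)\<close>, since
    \<open>?v (n + 2) / ?v n = x n * x (n + 1)\<close>.\<close>
  have x_rec: "x (Suc (Suc n)) = R * (1 - 1 / (x n * x (Suc n)))" for n
    using pos[of n] pos[of "Suc n"] pos[of "Suc (Suc n)"]
    by (simp add: x_def field_simps)
  have contract: "x (Suc (Suc n)) \<le> c * m" if "x n \<le> m" "x (Suc n) \<le> m" for n m
  proof -
    have "x n * x (Suc n) \<le> m\<^sup>2"
      unfolding power2_eq_square using that x_gt_1[of n] x_gt_1[of "Suc n"]
      by (intro mult_mono) auto
    moreover have "0 < x n * x (Suc n)"
      using x_gt_1[of n] x_gt_1[of "Suc n"] by (intro mult_pos_pos) auto
    ultimately have "1 / m\<^sup>2 \<le> 1 / (x n * x (Suc n))"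
      by (intro frac_le) auto
    then have "x (Suc (Suc n)) \<le> R * (1 - 1 / m\<^sup>2)"
      unfolding x_rec using assms by (intro mult_left_mono) auto
    also have "\<dots> = c * (3 / 2 * sqrt 3 * (1 - 1 / m\<^sup>2))"
      by (simp add: c(3))
    also have "\<dots> \<le> c * m"
      using that x_gt_1[of n] c by (intro mult_left_mono three_halves_sqrt3_minimum) auto
    finally show ?thesis .
  qed
  define m where "m = max (x 0) (x 1)"
  have m: "0 < m" using x_gt_1[of 0] by (simp add: m_def)
  \<comment> \<open>The contraction needs two consecutive bounds, so one factor \<open>c\<close> is
    gained per pair.\<close>
  have "x (2 * n) \<le> c ^ n * m \<and> x (Suc (2 * n)) \<le> c ^ n * m" for n
  proof (induction n)
    case 0
    show ?case by (simp add: m_def)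
  next
    case (Suc n)
    have le: "c * (c ^ n * m) \<le> c ^ n * m"
      using c m by (intro mult_left_le_one_le) auto
    have 1: "x (Suc (Suc (2 * n))) \<le> c * (c ^ n * m)"
      using Suc by (intro contract) auto
    then have "x (Suc (Suc (Suc (2 * n)))) \<le> c * (c ^ n * m)"
      using Suc le by (intro contract) auto
    with 1 show ?case by (simp add: algebra_simps)
  qed
  moreover obtain n where "c ^ n < 1 / m"
    using real_arch_pow_inv[of "1 / m" c] c m by auto
  then have "c ^ n * m < 1" using m by (simp add: field_simps)
  ultimately show False
    using x_gt_1[of "2 * n"] by (meson less_le_trans less_trans not_less)
qed

lemma adversary_weights_exist:
  assumes "1 \<le> R" and "R < 3 / 2 * sqrt 3"
  obtains w :: "nat \<Rightarrow> real" and N where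
    "\<And>i. 1 \<le> w i" "w (Suc N) \<le> w N" "\<And>n. n \<le> N \<Longrightarrow> R * w n \<le> alt_sum w (Suc n)"
proof -
  let ?v = "adv_weight R"
  define N where "N = (LEAST n. ?v (Suc n) \<le> ?v n)"
  have N: "?v (Suc N) \<le> ?v N"
    unfolding N_def using adv_weight_not_increasing[OF assms] by (rule LeastI_ex)
  have inc: "?v n < ?v (Suc n)" if "n < N" for n
    using not_less_Least[OF that[unfolded N_def]] by simp
  have ge1: "1 \<le> ?v n" if "n \<le> N" for n
    using that
  proof (induction n)
    case (Suc n)
    then show ?case using inc[of n] by simp
  qed simp
  \<comment> \<open>Beyond \<open>N\<close> the sequence may become nonpositive, so it is frozen
    there. Among the weights in the required sums only the one at \<open>N + 1\<close> changes, and
    it does not decrease.\<close>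
  define w where "w i = ?v (min i N)" for i
  show thesis
  proof (rule that[of w N])
    show "1 \<le> w i" for i by (simp add: w_def ge1)
    show "w (Suc N) \<le> w N" by (simp add: w_def)
    show "R * w n \<le> alt_sum w (Suc n)" if "n \<le> N" for n
    proof -
      have "?v i \<le> w i" if "i \<le> Suc n" for i
      proof (cases "i \<le> N")
        case False
        then have "i = Suc N" using that \<open>n \<le> N\<close> by linarith
        then show ?thesis using N by (simp add: w_def)
      qed (simp add: w_def)
      then have "alt_sum ?v (Suc n) \<le> alt_sum w (Suc n)" by (rule alt_sum_mono)
      then show ?thesis using that by (simp add: alt_sum_adv_weight w_def)
    qed
  qed
qed

section \<open>Schedules\<close>

lemma finite_completed: "finite I \<Longrightarrow> finite (completed I S)"
  by (simp add: completed_def)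

lemma profit_nonneg: "uniform_instance k I \<Longrightarrow> 0 \<le> profit I S"
  unfolding profit_def by (intro sum_nonneg) (auto simp: uniform_instance_def completed_def less_imp_le)

text \<open>Process each job of \<open>F\<close> throughout its own window; by disjointness no time
  is claimed twice.\<close>

lemma sum_weight_disjoint_windows_le_OPT:
  assumes inst: "uniform_instance k I" and "F \<subseteq> I"
    and room: "\<And>j. j \<in> F \<Longrightarrow> int k \<le> deadline j - release j"
    and disjoint: "\<And>i j t. i \<in> F \<Longrightarrow> j \<in> F \<Longrightarrow> release i \<le> t \<Longrightarrow> t < deadline i \<Longrightarrow>
      release j \<le> t \<Longrightarrow> t < deadline j \<Longrightarrow> i = j"
  shows "sum weight F \<le> OPT I"
proof -
  define P where "P t j \<longleftrightarrow> j \<in> F \<and> release j \<le> t \<and> t < deadline j" for t j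
  define S where "S t = (if \<exists>j. P t j then Some (SOME j. P t j) else None)" for t
  have S_eq: "S t = Some j \<longleftrightarrow> P t j" for t j
  proof
    assume "S t = Some j"
    then show "P t j"
      by (auto simp: S_def split: if_splits intro: someI)
  next
    assume P: "P t j"
    then have "P t (SOME j. P t j)" by (rule someI)
    with P have "(SOME j. P t j) = j"
      using disjoint unfolding P_def by blast
    with P show "S t = Some j" by (auto simp: S_def)
  qed
  have fin: "finite I" using inst by (simp add: uniform_instance_def)
  have "is_schedule I S"
    using \<open>F \<subseteq> I\<close> by (auto simp: is_schedule_def S_eq P_def)
  have "F \<subseteq> completed I S"
  proof
    fix j assume j: "j \<in> F"
    then have "{t. release j \<le> t \<and> t < deadline j \<and> S t = Some j} = {release j..<deadline j}"
      by (auto simp: S_eq P_def)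
    moreover have "ptime j = k"
      using inst j \<open>F \<subseteq> I\<close> by (auto simp: uniform_instance_def)
    ultimately show "j \<in> completed I S"
      using room[OF j] j \<open>F \<subseteq> I\<close> by (auto simp: completed_def)
  qed
  then have "sum weight F \<le> profit I S"
    unfolding profit_def using inst fin
    by (intro sum_mono2 finite_completed)
      (auto simp: uniform_instance_def completed_def less_imp_le)
  also have "\<dots> \<le> OPT I"
    using fin \<open>is_schedule I S\<close> by (rule profit_le_OPT)
  finally show ?thesis .
qed

text \<open>A tight window has exactly as many units as the job needs, so none can be
  spared.\<close>

lemma completed_tight_job:
  assumes "j \<in> completed I S" and "deadline j = release j + int (ptime j)"
    and "release j \<le> t" and "t < deadline j"
  shows "S t = Some j"
proof -
  let ?U = "{t. release j \<le> t \<and> t < deadline j \<and> S t = Some j}"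
  have "?U \<subseteq> {release j..<deadline j}" by auto
  moreover have "card {release j..<deadline j} \<le> card ?U"
    using assms by (simp add: completed_def)
  ultimately have "?U = {release j..<deadline j}"
    by (intro card_seteq) auto
  moreover have "t \<in> {release j..<deadline j}" using assms by simp
  ultimately have "t \<in> ?U" by (simp only:)
  then show ?thesis by (rule CollectE) simp
qed

section \<open>The adversary\<close>

text \<open>\<open>I\<^sub>0\<close> is over by time \<open>T\<close>, when the game begins. Neither
  time bound implies the other, as a deadline may precede the release.\<close>

locale adversary =
  fixes k :: nat and A :: algorithm and I\<^sub>0 :: "job set" and T :: int and w :: "nat \<Rightarrow> real"
  assumes k: "2 \<le> k"
    and I\<^sub>0: "uniform_instance k I\<^sub>0"
    and I\<^sub>0_before: "\<And>j. j \<in> I\<^sub>0 \<Longrightarrow> release j < T \<and> deadline j \<le> T"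
    and w_pos: "\<And>i. 0 < w i"
begin

text \<open>Even-indexed jobs start at \<open>T\<close>, \<open>T + k\<close>, ..., odd-indexed ones
  one unit later. Thus successive windows of equal parity abut, and the gaps between consecutive
  starts alternate between 1 and \<open>k - 1\<close>.\<close>

definition start :: "nat \<Rightarrow> int" where
  "start i = T + int (i div 2) * int k + int (i mod 2)"

definition adv_job :: "nat \<Rightarrow> job" where
  "adv_job i = Job 0 (start i) k (start i + int k) (w i)"

definition inst :: "nat \<Rightarrow> job set" where
  "inst n = I\<^sub>0 \<union> adv_job ` {..<n}"

text \<open>At \<open>start n\<close> the algorithm knows just \<open>inst (Suc n)\<close>, however
  many jobs come later, so its decision does not depend on where the adversary stops.\<close>

definition follows :: "nat \<Rightarrow> bool" where
  "follows n \<longleftrightarrow> A (start n) (inst (Suc n)) = Some (adv_job n)"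

lemma adv_job_sel [simp]:
  "release (adv_job i) = start i" "ptime (adv_job i) = k"
  "deadline (adv_job i) = start i + int k" "weight (adv_job i) = w i"
  by (simp_all add: adv_job_def)

lemma start_Suc_Suc: "start (Suc (Suc i)) = start i + int k"
  by (simp add: start_def algebra_simps)

lemma start_Suc: "start i < start (Suc i)" "start (Suc i) < start i + int k"
proof -
  \<comment> \<open>As \<open>2 \<le> k\<close>, either gap is positive and less than
    \<open>k\<close>.\<close>
  have "start (Suc i) = start i + 1 \<or> start (Suc i) = start i + int k - 1"
  proof (cases "even i")
    case True
    then have "start (Suc i) = start i + 1"
      by (auto simp: start_def elim!: evenE)
    then show ?thesis ..
  next
    case False
    then obtain b where "i = 2 * b + 1" by (rule oddE)
    then have "start (Suc i) = start i + int k - 1"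
      by (simp add: start_def distrib_right)
    then show ?thesis ..
  qed
  then show "start i < start (Suc i)" "start (Suc i) < start i + int k"
    using k by auto
qed

lemma strict_mono_start: "strict_mono start"
  using start_Suc(1) by (simp add: strict_mono_Suc_iff)

lemma start_less_iff [simp]: "start i < start j \<longleftrightarrow> i < j"
  and start_le_iff [simp]: "start i \<le> start j \<longleftrightarrow> i \<le> j"
  using strict_mono_start by (simp_all add: strict_mono_less strict_mono_less_eq)

lemma T_le_start: "T \<le> start i"
  by (simp add: start_def)

lemma inj_adv_job: "inj adv_job"
proof (rule injI)
  fix i j assume "adv_job i = adv_job j"
  then have "start i = start j" by (metis adv_job_sel(1))
  then show "i = j" using strict_mono_start by (simp add: strict_mono_eq)
qed

lemma adv_job_notin [simp]: "adv_job i \<notin> I\<^sub>0"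
  using I\<^sub>0_before[of "adv_job i"] T_le_start[of i] by auto

lemma uniform_inst: "uniform_instance k (inst n)"
  using I\<^sub>0 by (auto simp: uniform_instance_def inst_def w_pos)

lemma same_parity_gap:
  assumes "i < j" and "even i \<longleftrightarrow> even j"
  shows "start i + int k \<le> start j"
proof -
  have "Suc (Suc i) \<le> j" using assms by (metis Suc_leI even_Suc le_neq_implies_less)
  then show ?thesis by (simp flip: start_Suc_Suc)
qed

lemma alt_sum_le_OPT: "alt_sum w n \<le> OPT (inst (Suc n))"
proof -
  let ?P = "{i. i \<le> n \<and> (even i \<longleftrightarrow> even n)}"
  have "alt_sum w n = sum weight (adv_job ` ?P)"
    unfolding alt_sum_def by (subst sum.reindex) (auto intro: inj_on_subset[OF inj_adv_job])
  also have "\<dots> \<le> OPT (inst (Suc n))"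
  proof (rule sum_weight_disjoint_windows_le_OPT[OF uniform_inst])
    show "adv_job ` ?P \<subseteq> inst (Suc n)" by (auto simp: inst_def)
  next
    fix a b t
    assume "a \<in> adv_job ` ?P" "b \<in> adv_job ` ?P"
      and t: "release a \<le> t" "t < deadline a" "release b \<le> t" "t < deadline b"
    then obtain i j where ij: "a = adv_job i" "b = adv_job j" "even i \<longleftrightarrow> even j"
      by auto
    then show "a = b"
      using t same_parity_gap[of i j] same_parity_gap[of j i]
      by (cases i j rule: linorder_cases) auto
  qed auto
  finally show ?thesis .
qed

section \<open>Knowledge and profit of the algorithm during the game\<close>

lemma released_inst_start: "n < m \<Longrightarrow> released (inst m) (start n) = inst (Suc n)"
proof -
  assume "n < m"
  have "release j \<le> start n" if "j \<in> I\<^sub>0" for j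
    using I\<^sub>0_before[OF that] T_le_start[of n] by linarith
  with \<open>n < m\<close> show ?thesis
    by (auto simp: released_def inst_def less_Suc_eq_le)
qed

lemma released_inst_before: "t < T \<Longrightarrow> released (inst m) t = released I\<^sub>0 t"
proof -
  assume "t < T"
  then have "\<not> start i \<le> t" for i
    using T_le_start[of i] by linarith
  then show ?thesis
    by (auto simp: released_def inst_def)
qed

lemma run_start: "n < m \<Longrightarrow> run A (inst m) (start n) = Some (adv_job n) \<longleftrightarrow> follows n"
  by (simp add: run_def released_inst_start follows_def)

text \<open>Before \<open>T\<close> the algorithm sees only jobs of \<open>I\<^sub>0\<close>, and
  their windows end by \<open>T\<close>.\<close>

lemma completed_inst_old:
  "completed (inst m) (run A (inst m)) \<inter> I\<^sub>0 = completed I\<^sub>0 (run A I\<^sub>0)"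
proof -
  have "{t. release j \<le> t \<and> t < deadline j \<and> run A (inst m) t = Some j} =
      {t. release j \<le> t \<and> t < deadline j \<and> run A I\<^sub>0 t = Some j}" if "j \<in> I\<^sub>0" for j
    using I\<^sub>0_before[OF that] by (force simp: run_def released_inst_before)
  then show ?thesis
    by (auto simp: completed_def inst_def)
qed

definition adv_done :: "nat \<Rightarrow> nat set" where
  "adv_done m = {i. i < m \<and> adv_job i \<in> completed (inst m) (run A (inst m))}"

lemma ALG_inst: "ALG A (inst m) = ALG A I\<^sub>0 + (\<Sum>i\<in>adv_done m. w i)"
proof -
  let ?C = "completed (inst m) (run A (inst m))"
  have "?C = (?C \<inter> I\<^sub>0) \<union> adv_job ` adv_done m"
  proof -
    have "?C \<subseteq> I\<^sub>0 \<union> adv_job ` {..<m}"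
      by (auto simp: completed_def inst_def)
    then show ?thesis unfolding adv_done_def by blast
  qed
  then have split: "?C = completed I\<^sub>0 (run A I\<^sub>0) \<union> adv_job ` adv_done m"
    by (simp only: completed_inst_old)
  have "finite (completed I\<^sub>0 (run A I\<^sub>0))"
    using I\<^sub>0 by (simp add: uniform_instance_def finite_completed)
  moreover have "finite (adv_done m)" by (simp add: adv_done_def)
  moreover have "completed I\<^sub>0 (run A I\<^sub>0) \<inter> adv_job ` adv_done m = {}"
    by (auto simp: completed_def)
  ultimately have "sum weight ?C = ALG A I\<^sub>0 + sum weight (adv_job ` adv_done m)"
    unfolding split by (simp add: sum.union_disjoint ALG_def profit_def)
  also have "sum weight (adv_job ` adv_done m) = (\<Sum>i\<in>adv_done m. w i)"
    by (subst sum.reindex) (auto intro: inj_on_subset[OF inj_adv_job])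
  finally show ?thesis by (simp add: ALG_def profit_def)
qed

lemma ALG_inst_ge: "ALG A I\<^sub>0 \<le> ALG A (inst m)"
  unfolding ALG_inst using w_pos by (simp add: sum_nonneg less_imp_le)

text \<open>A completed tight job fills its window, which contains both \<open>start i\<close> and
  \<open>start (Suc i)\<close>.\<close>

lemma adv_done_follows:
  assumes "i \<in> adv_done m"
  shows "follows i" and "Suc i < m \<Longrightarrow> \<not> follows (Suc i)"
proof -
  have i: "i < m" "adv_job i \<in> completed (inst m) (run A (inst m))"
    using assms by (auto simp: adv_done_def)
  have busy: "run A (inst m) t = Some (adv_job i)" if "start i \<le> t" "t < start i + int k" for t
    using completed_tight_job[OF i(2), of t] that by simp
  show "follows i"
    using busy[of "start i"] i k by (simp add: run_start)
  show "\<not> follows (Suc i)" if "Suc i < m"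
  proof
    assume "follows (Suc i)"
    then have "run A (inst m) (start (Suc i)) = Some (adv_job (Suc i))"
      using that by (simp add: run_start)
    moreover have "run A (inst m) (start (Suc i)) = Some (adv_job i)"
      using start_Suc[of i] by (intro busy) auto
    ultimately show False
      using injD[OF inj_adv_job, of "Suc i" i] by simp
  qed
qed

lemma ALG_inst_le:
  assumes "adv_done m \<subseteq> {n}"
  shows "ALG A (inst m) \<le> ALG A I\<^sub>0 + w n"
proof -
  have "(\<Sum>i\<in>adv_done m. w i) \<le> (\<Sum>i\<in>{n}. w i)"
    using assms w_pos by (intro sum_mono2) (auto intro: less_imp_le)
  then show ?thesis by (simp add: ALG_inst)
qed

text \<open>The adversary stops at the first job not started, at the latest with
  \<open>adv_job (Suc N)\<close>. The bound \<open>M\<close> later lets the optimum outweigh the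
  profit from \<open>I\<^sub>0\<close>.\<close>

lemma adversary_wins:
  assumes R: "0 \<le> R" and last: "w (Suc N) \<le> w N"
    and ratio: "\<And>n. n \<le> N \<Longrightarrow> R * w n \<le> alt_sum w (Suc n)"
    and M: "\<And>i. M \<le> w i"
  shows "\<exists>m. M \<le> OPT (inst m) \<and> R * (ALG A (inst m) - ALG A I\<^sub>0) \<le> OPT (inst m)"
proof -
  have M_le: "M \<le> OPT (inst (Suc n))" for n
  proof -
    have "M \<le> (\<Sum>i\<in>{n}. w i)" using M by simp
    also have "\<dots> \<le> alt_sum w n"
      unfolding alt_sum_def using w_pos by (intro sum_mono2) (auto intro: less_imp_le)
    also note alt_sum_le_OPT
    finally show ?thesis .
  qed
  have win: ?thesis if "n \<le> N" "ALG A (inst (Suc (Suc n))) \<le> ALG A I\<^sub>0 + w n" for n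
  proof -
    have "R * (ALG A (inst (Suc (Suc n))) - ALG A I\<^sub>0) \<le> R * w n"
      using that R by (intro mult_left_mono) auto
    also have "\<dots> \<le> alt_sum w (Suc n)" using that by (intro ratio)
    also note alt_sum_le_OPT
    finally show ?thesis using M_le by blast
  qed
  show ?thesis
  proof (cases "\<forall>n\<le>Suc N. follows n")
    case True
    \<comment> \<open>Every job but the last was abandoned for its successor. The last weighs at
      most \<open>w N\<close>, so \<open>win\<close> applies with \<open>n = N\<close>.\<close>
    have "adv_done (Suc (Suc N)) \<subseteq> {Suc N}"
    proof
      fix i assume i: "i \<in> adv_done (Suc (Suc N))"
      then have "i \<le> Suc N" by (auto simp: adv_done_def)
      moreover have "\<not> Suc i < Suc (Suc N)"
        using adv_done_follows(2)[OF i] True by auto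
      ultimately show "i \<in> {Suc N}" by auto
    qed
    from ALG_inst_le[OF this] last show ?thesis
      by (intro win[of N]) auto
  next
    case False
    then obtain q where q: "\<not> follows q" "q \<le> Suc N" by auto
    define n where "n = (LEAST n. \<not> follows n)"
    have n: "\<not> follows n"
      unfolding n_def using q(1) by (rule LeastI)
    have before: "follows i" if "i < n" for i
      using not_less_Least[OF that[unfolded n_def]] by simp
    have "n \<le> Suc N"
      using Least_le[of "\<lambda>n. \<not> follows n", OF q(1)] q(2) unfolding n_def by linarith
    show ?thesis
    proof (cases n)
      case 0
      have "adv_done (Suc 0) = {}"
        using adv_done_follows(1)[of _ "Suc 0"] n 0 by (auto simp: adv_done_def)
      then have "R * (ALG A (inst (Suc 0)) - ALG A I\<^sub>0) = 0"
        by (simp add: ALG_inst)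
      moreover have "0 \<le> OPT (inst (Suc 0))"
        using alt_sum_le_OPT[of 0] w_pos[of 0] by (simp add: alt_sum_0)
      ultimately show ?thesis using M_le[of 0] by (intro exI[of _ "Suc 0"]) auto
    next
      case (Suc p)
      \<comment> \<open>Jobs before \<open>p\<close> were abandoned for their successors, and job
        \<open>Suc p\<close> was not started at its release.\<close>
      have "adv_done (Suc (Suc p)) \<subseteq> {p}"
      proof
        fix i assume i: "i \<in> adv_done (Suc (Suc p))"
        then have "i \<le> Suc p" by (auto simp: adv_done_def)
        moreover have "i \<noteq> Suc p"
          using adv_done_follows(1)[OF i] n Suc by auto
        moreover have "\<not> i < p"
          using adv_done_follows(2)[OF i] before[of "Suc i"] Suc by auto
        ultimately show "i \<in> {p}" by auto
      qed
      then show ?thesis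
        using \<open>n \<le> Suc N\<close> Suc by (intro win[of p] ALG_inst_le) auto
    qed
  qed
qed

end

section \<open>From the game to the competitive ratio\<close>

lemma ALG_nonneg: "uniform_instance k I \<Longrightarrow> 0 \<le> ALG A I"
  unfolding ALG_def by (rule profit_nonneg)

lemma extend_to_bad_instance:
  fixes R :: real
  assumes "2 \<le> k" and I\<^sub>0: "uniform_instance k I\<^sub>0" and "R < 3 / 2 * sqrt 3"
  shows "\<exists>I. uniform_instance k I \<and> ALG A I\<^sub>0 \<le> ALG A I \<and> R * ALG A I \<le> OPT I \<and> 0 < OPT I"
proof -
  let ?L = "3 / 2 * sqrt 3 :: real"
  \<comment> \<open>The weights need a ratio of at least 1. The game is played for
    \<open>Q > r\<close>, and the surplus \<open>Q - r\<close> pays for the profit \<open>a\<close>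
    from \<open>I\<^sub>0\<close>.\<close>
  define r where "r = max R 1"
  define Q where "Q = (r + ?L) / 2"
  define a where "a = ALG A I\<^sub>0"
  \<comment> \<open>Chosen so that \<open>r * a * Q \<le> (Q - r) * M\<close>; the summand 1 keeps
    the optimum positive.\<close>
  define M where "M = 1 + r * a * Q / (Q - r)"
  have "1 < sqrt (3::real)" by simp
  then have "1 < ?L" by linarith
  then have "r < ?L" using assms by (simp add: r_def)
  then have Q: "1 \<le> r" "r < Q" "1 \<le> Q" "Q < ?L"
    by (auto simp: Q_def r_def)
  have a: "0 \<le> a" using I\<^sub>0 by (simp add: a_def ALG_nonneg)
  then have M: "1 \<le> M" using Q by (simp add: M_def)
  obtain w N where w: "\<And>i. 1 \<le> w i" "w (Suc N) \<le> w N"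
      "\<And>n. n \<le> N \<Longrightarrow> Q * w n \<le> alt_sum w (Suc n)"
    using adversary_weights_exist[OF Q(3,4)] by metis
  have fin: "finite I\<^sub>0" using I\<^sub>0 by (simp add: uniform_instance_def)
  define T where "T = Max (insert 0 ((\<lambda>j. max (release j + 1) (deadline j)) ` I\<^sub>0))"
  have T: "release j < T \<and> deadline j \<le> T" if "j \<in> I\<^sub>0" for j
  proof -
    have "max (release j + 1) (deadline j) \<le> T"
      unfolding T_def using fin that by (intro Max_ge) auto
    then show ?thesis by auto
  qed
  have M_le: "M \<le> M * w i" for i
    using mult_left_mono[OF w(1)[of i], of M] M by simp
  interpret adversary k A I\<^sub>0 T "\<lambda>i. M * w i"
  proof
    show "0 < M * w i" for i using M_le[of i] M by linarith
  qed (use assms T in auto)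
  have "\<exists>m. M \<le> OPT (inst m) \<and> Q * (ALG A (inst m) - ALG A I\<^sub>0) \<le> OPT (inst m)"
  proof (rule adversary_wins)
    show "0 \<le> Q" using Q by simp
    show "M * w (Suc N) \<le> M * w N" using w(2) M by (intro mult_left_mono) auto
    show "Q * (M * w n) \<le> alt_sum (\<lambda>i. M * w i) (Suc n)" if "n \<le> N" for n
      using mult_left_mono[OF w(3)[OF that], of M] M by (simp add: alt_sum_scale ac_simps)
  qed (rule M_le)
  then obtain m where m: "M \<le> OPT (inst m)" "Q * (ALG A (inst m) - a) \<le> OPT (inst m)"
    unfolding a_def by auto
  let ?O = "OPT (inst m)" and ?a = "ALG A (inst m)"
  have "R * ?a \<le> r * ?a"
    using ALG_nonneg[OF uniform_inst] by (intro mult_right_mono) (auto simp: r_def)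
  also have "\<dots> \<le> ?O"
  proof -
    have "r * a * Q \<le> (Q - r) * M"
      using Q by (simp add: M_def distrib_left)
    also have "\<dots> \<le> (Q - r) * ?O" using m Q by (intro mult_left_mono) auto
    finally have "r * a * Q \<le> (Q - r) * ?O" .
    moreover have "r * (Q * (?a - a)) \<le> r * ?O"
      using m Q by (intro mult_left_mono) auto
    ultimately have "Q * (r * ?a) \<le> Q * ?O" by (simp add: algebra_simps)
    then show ?thesis using Q by simp
  qed
  finally show ?thesis
    using uniform_inst ALG_inst_ge m M by (intro exI[of _ "inst m"]) auto
qed

text \<open>The premise of the first part sets aside algorithms that never earn anything, for which
  no instance has positive profit; the bound on the ratio covers them too.\<close>

theorem theorem4:
  fixes k :: nat and A :: algorithm
  assumes "k \<ge> 2" and "online_algorithm A"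
  shows "((\<exists>I. uniform_instance k I \<and> ALG A I > 0) \<longrightarrow>
           (\<forall>R::real. R < 3 / 2 * sqrt 3 \<longrightarrow>
             (\<exists>I. uniform_instance k I \<and> OPT I \<ge> R * ALG A I \<and> ALG A I > 0)))
         \<and> competitive_ratio k A \<ge> ereal (3 / 2 * sqrt 3)"
proof (intro conjI impI allI)
  fix R :: real
  assume "\<exists>I. uniform_instance k I \<and> ALG A I > 0" and R: "R < 3 / 2 * sqrt 3"
  then obtain I\<^sub>0 where "uniform_instance k I\<^sub>0" "ALG A I\<^sub>0 > 0" by blast
  with extend_to_bad_instance[OF assms(1) this(1) R, of A]
  show "\<exists>I. uniform_instance k I \<and> OPT I \<ge> R * ALG A I \<and> ALG A I > 0"
    by (meson less_le_trans)
next
  have "3 / 2 * sqrt 3 \<le> R"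
    if R: "\<And>I. uniform_instance k I \<Longrightarrow> OPT I \<le> R * ALG A I" for R :: real
  proof (rule ccontr)
    assume "\<not> ?thesis"
    then obtain Q where Q: "R < Q" "Q < 3 / 2 * sqrt 3" using dense by (metis not_le)
    \<comment> \<open>The game can start from nothing here: positive profit follows from
      \<open>0 < OPT I\<close> and \<open>OPT I \<le> R * ALG A I\<close>.\<close>
    have "uniform_instance k {}" by (simp add: uniform_instance_def)
    from extend_to_bad_instance[OF assms(1) this Q(2), of A]
    obtain I where I: "uniform_instance k I" "Q * ALG A I \<le> OPT I" "0 < OPT I" by blast
    have "0 < R * ALG A I" using R[OF I(1)] I(3) by linarith
    then have "0 < ALG A I"
      using ALG_nonneg[OF I(1), of A] by (cases "ALG A I = 0") auto
    then have "R * ALG A I < Q * ALG A I" using Q by simp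
    then show False using R[OF I(1)] I(2) by linarith
  qed
  then show "competitive_ratio k A \<ge> ereal (3 / 2 * sqrt 3)"
    unfolding competitive_ratio_def by (auto intro!: Inf_greatest)
qed

end
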